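(* Let $S'=U/\Gamma'$ and $S''=U/\Gamma''$ be Inoue surfaces with covering projections $p':U\to S'$, $p'':U\to S''$, let $f:S'\to S''$ be a biholomorphism, and let $\tilde f:U\to U$ be a lift of $f$ (a biholomorphism with $p''\circ\tilde f=f\circ p'$). Then $\tilde f\in\mathrm{Aff}(U)$.
   Context: Notation: $\mathbb{N}^*=\{1,2,\dots\}$; $H=\{w\in\mathbb{C}\mid \mathrm{Im}(w)>0\}$; $U=H\times\mathbb{C}\subset\mathbb{C}^2$ with coordinates $(w,z)$; $\mathrm{Aff}(U)$ is the group of complex affine transformations $f$ of $\mathbb{C}^2$ with $f(U)=U$, identified with their restrictions to $U$. For $x,y\in\mathbb{C}^2$, $x\wedge y=x_1y_2-x_2y_1$. An Inoue surface is a quotient $S=U/\Gamma$, where $\Gamma\subset\mathrm{Aff}(U)$ is one of the following groups (each acts properly discontinuously on $U$, and $U\to S$ is the universal covering of the compact complex surface $S$). Type I. A number $\beta\in\mathbb{C}\setminus\mathbb{R}$ with $|\beta|<1$ is admissible if $|\beta|^{-2},\beta,\bar\beta$ are the roots of a polynomial $X^3-\theta_2X^2+\theta_1X-1$ with $\theta_1,\theta_2\in\mathbb{Z}$. A pair $(a,b)\in\mathbb{R}^3\times\mathbb{C}^3$ is $\beta$-compatible if $a,b,\bar b$ are linearly independent over $\mathbb{C}$ and, $P$ being the matrix with columns $a,b,\bar b$, $P\,\mathrm{diag}(|\beta|^{-2},\beta,\bar\beta)\,P^{-1}\in M_3(\mathbb{Z})$. Then $\Gamma=G(\beta,a,b)$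 is generated by $g_0:(w,z)\mapsto(|\beta|^{-2}w,\beta z)$ and $g_i:(w,z)\mapsto(w+a_i,z+b_i)$, $1\le i\le3$. Type II. $\alpha=\frac{\theta+\sqrt{\theta^2-4}}{2}$ with $\theta\in\mathbb{Z}$, $\theta\ge3$; $(a,b)\in\mathbb{R}^2\times\mathbb{R}^2$ is a linearly independent pair such that, $P$ being the matrix with columns $a,b$, $N=(n_{ij}):=P\,\mathrm{diag}(\alpha,\alpha^{-1})P^{-1}\in M_2(\mathbb{Z})$; $r\in\mathbb{N}^*$; $c\in\mathbb{R}^2$ satisfies $$(I_2-N)\Big(c-\tfrac12\begin{pmatrix}a_1b_1\\ a_2b_2\end{pmatrix}\Big)-\tfrac{b\wedge a}{2}\begin{pmatrix}n_{11}n_{12}\\ n_{21}n_{22}\end{pmatrix}\in\tfrac{b\wedge a}{r}\mathbb{Z}^2;$$ $t\in\mathbb{C}$. Then $\Gamma=G(\alpha,a,b,c,r,t)$ is generated by $g_0:(w,z)\mapsto(\alpha w,z+t)$, $g_i:(w,z)\mapsto(w+a_i,z+b_iw+c_i)$ ($i=1,2$), $g_3:(w,z)\mapsto(w,z+\frac{b\wedge a}{r})$. Type III. $\alpha=\frac{\theta+\sqrt{\theta^2+4}}{2}$ with $\theta\in\mathbb{N}^*$; $(a,b)\in\mathbb{R}^2\times\mathbb{R}^2$ is a linearly independent pair such that, with $P$ as for type II, $N=(n_{ij}):=P\,\mathrm{diag}(\alpha,-\alpha^{-1})P^{-1}\in M_2(\mathbb{Z})$; $r\in\mathbb{N}^*$;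 $c\in\mathbb{R}^2$ satisfies $$(I_2+N)\Big(c-\tfrac12\begin{pmatrix}a_1b_1\\ a_2b_2\end{pmatrix}\Big)-\tfrac{a\wedge b}{2}\begin{pmatrix}n_{11}n_{12}\\ n_{21}n_{22}\end{pmatrix}\in\tfrac{a\wedge b}{r}\mathbb{Z}^2.$$ Then $\Gamma=G(\alpha,a,b,c,r)$ is generated by $g_0:(w,z)\mapsto(\alpha w,-z)$ and $g_1,g_2,g_3$ given by the same formulae as for type II. *)

theory Defs
  imports "HOL-Analysis.Analysis" "HOL-Computational_Algebra.Polynomial" "HOL-Algebra.Generated_Groups"
begin

section \<open>The domain and its affine transformations\<close>

definition upper_half :: "complex set" where
  "upper_half = {w. Im w > 0}"

definition U :: "(complex \<times> complex) set" where
  "U = upper_half \<times> UNIV"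

definition affine_transformation :: "(complex \<times> complex \<Rightarrow> complex \<times> complex) \<Rightarrow> bool" where
  "affine_transformation F \<longleftrightarrow>
    (\<exists>m11 m12 m21 m22 v1 v2. m11 * m22 - m12 * m21 \<noteq> 0 \<and>
      F = (\<lambda>(w, z). (m11 * w + m12 * z + v1, m21 * w + m22 * z + v2)))"

definition Aff_U :: "(complex \<times> complex \<Rightarrow> complex \<times> complex) set" where
  "Aff_U = {F. affine_transformation F \<and> F ` U = U}"

definition Aff_U_group :: "(complex \<times> complex \<Rightarrow> complex \<times> complex) monoid" where
  "Aff_U_group = \<lparr>carrier = Aff_U, mult = (\<circ>), one = id\<rparr>"

lemma affine_transformation_id: "affine_transformation id"
  unfolding affine_transformation_def
  by (rule exI[of _ 1], rule exI[of _ 0], rule exI[of _ 0], rule exI[of _ 1],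
      rule exI[of _ 0], rule exI[of _ 0]) (auto simp: fun_eq_iff)

lemma affine_transformation_comp:
  assumes "affine_transformation F" "affine_transformation G"
  shows "affine_transformation (F \<circ> G)"
proof -
  obtain p q r s u v where F: "p * s - q * r \<noteq> 0"
    "F = (\<lambda>(w, z). (p * w + q * z + u, r * w + s * z + v))"
    using assms(1) unfolding affine_transformation_def by blast
  obtain p' q' r' s' u' v' where G: "p' * s' - q' * r' \<noteq> 0"
    "G = (\<lambda>(w, z). (p' * w + q' * z + u', r' * w + s' * z + v'))"
    using assms(2) unfolding affine_transformation_def by blast
  have "(p * p' + q * r') * (r * q' + s * s') - (p * q' + q * s') * (r * p' + s * r')
      = (p * s - q * r) * (p' * s' - q' * r')"
    by (simp add: algebra_simps)
  with F(1) G(1) have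
    "(p * p' + q * r') * (r * q' + s * s') - (p * q' + q * s') * (r * p' + s * r') \<noteq> 0"
    by simp
  moreover have "F \<circ> G = (\<lambda>(w, z).
      ((p * p' + q * r') * w + (p * q' + q * s') * z + (p * u' + q * v' + u),
       (r * p' + s * r') * w + (r * q' + s * s') * z + (r * u' + s * v' + v)))"
    by (auto simp: F(2) G(2) fun_eq_iff algebra_simps)
  ultimately show ?thesis
    unfolding affine_transformation_def by blast
qed

lemma affine_transformation_inverse:
  assumes "affine_transformation F"
  obtains G where "affine_transformation G" "G \<circ> F = id" "F \<circ> G = id"
proof -
  obtain p q r s u v where F: "p * s - q * r \<noteq> 0"
    "F = (\<lambda>(w, z). (p * w + q * z + u, r * w + s * z + v))"
    using assms unfolding affine_transformation_def by blast
  define d where "d = p * s - q * r"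
  have d: "d \<noteq> 0" using F(1) by (simp add: d_def)
  define G where "G = (\<lambda>(w, z). (s / d * w + (- q / d) * z + (q * v - s * u) / d,
      (- r / d) * w + p / d * z + (r * u - p * v) / d))"
  have "s / d * (p / d) - (- q / d) * (- r / d) = d / (d * d)"
    using d by (simp add: d_def diff_divide_distrib mult.commute)
  with d have "s / d * (p / d) - (- q / d) * (- r / d) \<noteq> 0" by simp
  then have "affine_transformation G"
    unfolding affine_transformation_def G_def by blast
  moreover have "G (F (w, z)) = (w, z)" for w z
  proof -
    have "s * (p * w + q * z + u) - q * (r * w + s * z + v) + (q * v - s * u) = d * w"
         "- r * (p * w + q * z + u) + p * (r * w + s * z + v) + (r * u - p * v) = d * z"
      by (simp_all add: d_def algebra_simps)
    with d show ?thesis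
      by (simp add: G_def F(2) add_divide_distrib [symmetric] diff_divide_distrib [symmetric])
  qed
  moreover have "F (G (w, z)) = (w, z)" for w z
  proof -
    have "p * (s * w - q * z + (q * v - s * u)) + q * (- r * w + p * z + (r * u - p * v)) + u * d
        = d * w"
         "r * (s * w - q * z + (q * v - s * u)) + s * (- r * w + p * z + (r * u - p * v)) + v * d
        = d * z"
      by (simp_all add: d_def algebra_simps)
    then have "(p * (s * w - q * z + (q * v - s * u)) + q * (- r * w + p * z + (r * u - p * v))
          + u * d) / d = w"
         "(r * (s * w - q * z + (q * v - s * u)) + s * (- r * w + p * z + (r * u - p * v))
          + v * d) / d = z"
      using d by simp_all
    with d show ?thesis
      by (simp add: G_def F(2) add_divide_distrib [symmetric] diff_divide_distrib [symmetric]
          divide_add_eq_iff)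
  qed
  ultimately show ?thesis by (intro that[of G]) (auto simp: fun_eq_iff)
qed

lemma group_Aff_U: "group Aff_U_group"
proof (rule groupI)
  fix F G assume "F \<in> carrier Aff_U_group" "G \<in> carrier Aff_U_group"
  then have FG: "affine_transformation F" "F ` U = U" "affine_transformation G" "G ` U = U"
    by (auto simp: Aff_U_group_def Aff_U_def)
  have "(F \<circ> G) ` U = U" by (simp only: image_comp [symmetric] FG)
  with FG show "F \<otimes>\<^bsub>Aff_U_group\<^esub> G \<in> carrier Aff_U_group"
    by (simp add: Aff_U_group_def Aff_U_def affine_transformation_comp)
next
  fix F assume "F \<in> carrier Aff_U_group"
  then have F: "affine_transformation F" "F ` U = U"
    by (auto simp: Aff_U_group_def Aff_U_def)
  obtain G where G: "affine_transformation G" "G \<circ> F = id" "F \<circ> G = id"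
    by (rule affine_transformation_inverse[OF F(1)])
  have "G ` U = (G \<circ> F) ` U" by (simp only: image_comp [symmetric] F(2))
  then have "G ` U = U" by (simp add: G(2))
  with G show "\<exists>G\<in>carrier Aff_U_group. G \<otimes>\<^bsub>Aff_U_group\<^esub> F = \<one>\<^bsub>Aff_U_group\<^esub>"
    by (auto simp: Aff_U_group_def Aff_U_def)
qed (auto simp: Aff_U_group_def Aff_U_def affine_transformation_id o_assoc)

section \<open>The groups of Inoue surfaces\<close>

definition diag :: "'a::zero ^ 'n \<Rightarrow> 'a ^ 'n ^ 'n" where
  "diag d = (\<chi> i j. if i = j then d $ i else 0)"

definition integral_matrix :: "'a::ring_1 ^ 'n ^ 'm \<Rightarrow> bool" where
  "integral_matrix A \<longleftrightarrow> (\<forall>i j. A $ i $ j \<in> \<int>)"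

definition wedge :: "'a::comm_ring_1 ^ 2 \<Rightarrow> 'a ^ 2 \<Rightarrow> 'a"  (infixl "\<and>\<^sub>w" 70) where
  "x \<and>\<^sub>w y = x $ 1 * y $ 2 - x $ 2 * y $ 1"

subsection \<open>Type I\<close>

definition admissible :: "complex \<Rightarrow> bool" where
  "admissible \<beta> \<longleftrightarrow> \<beta> \<notin> \<real> \<and> cmod \<beta> < 1 \<and>
    (\<exists>\<theta>1 \<theta>2 :: int.
      {x. poly [:-1, of_int \<theta>1, - of_int \<theta>2, 1:] x = 0}
        = {complex_of_real (cmod \<beta> powi (-2)), \<beta>, cnj \<beta>})"

definition compatible :: "complex \<Rightarrow> real ^ 3 \<Rightarrow> complex ^ 3 \<Rightarrow> bool" where
  "compatible \<beta> a b \<longleftrightarrow>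
    (let a' = (\<chi> i. complex_of_real (a $ i));
         b' = (\<chi> i. cnj (b $ i));
         P = transpose (vector [a', b, b'] :: complex ^ 3 ^ 3)
     in distinct [a', b, b'] \<and> vec.independent {a', b, b'} \<and>
        integral_matrix
          (P ** diag (vector [complex_of_real (cmod \<beta> powi (-2)), \<beta>, cnj \<beta>]) ** matrix_inv P))"

definition G1 :: "complex \<Rightarrow> real ^ 3 \<Rightarrow> complex ^ 3 \<Rightarrow> (complex \<times> complex \<Rightarrow> complex \<times> complex) set" where
  "G1 \<beta> a b = generate Aff_U_group
    (insert (\<lambda>(w, z). (complex_of_real (cmod \<beta> powi (-2)) * w, \<beta> * z))
       {(\<lambda>(w, z). (w + complex_of_real (a $ i), z + b $ i)) | i. True})"

definition type_I :: "(complex \<times> complex \<Rightarrow> complex \<times> complex) set \<Rightarrow> bool" where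
  "type_I \<Gamma> \<longleftrightarrow> (\<exists>\<beta> a b. admissible \<beta> \<and> compatible \<beta> a b \<and> \<Gamma> = G1 \<beta> a b)"

subsection \<open>Types II and III\<close>

text \<open>For independent \<open>a\<close>, \<open>b\<close>, the matrix with eigenvalues \<open>x\<close>, \<open>y\<close> for the eigenvectors
  \<open>a\<close>, \<open>b\<close>.\<close>

definition conj_matrix :: "real ^ 2 \<Rightarrow> real ^ 2 \<Rightarrow> real \<Rightarrow> real \<Rightarrow> real ^ 2 ^ 2" where
  "conj_matrix a b x y =
    (let P = transpose (vector [a, b] :: real ^ 2 ^ 2) in P ** diag (vector [x, y]) ** matrix_inv P)"

definition heis :: "real ^ 2 \<Rightarrow> real ^ 2 \<Rightarrow> real ^ 2 \<Rightarrow> nat \<Rightarrow> (complex \<times> complex \<Rightarrow> complex \<times> complex) set" where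
  "heis a b c r =
    insert (\<lambda>(w, z). (w, z + complex_of_real (b \<and>\<^sub>w a / real r)))
      {(\<lambda>(w, z). (w + complex_of_real (a $ i),
          z + complex_of_real (b $ i) * w + complex_of_real (c $ i))) | i. True}"

definition G2 :: "real \<Rightarrow> real ^ 2 \<Rightarrow> real ^ 2 \<Rightarrow> real ^ 2 \<Rightarrow> nat \<Rightarrow> complex \<Rightarrow>
    (complex \<times> complex \<Rightarrow> complex \<times> complex) set" where
  "G2 \<alpha> a b c r t = generate Aff_U_group
    (insert (\<lambda>(w, z). (complex_of_real \<alpha> * w, z + t)) (heis a b c r))"

definition G3 :: "real \<Rightarrow> real ^ 2 \<Rightarrow> real ^ 2 \<Rightarrow> real ^ 2 \<Rightarrow> nat \<Rightarrow>
    (complex \<times> complex \<Rightarrow> complex \<times> complex) set" where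
  "G3 \<alpha> a b c r = generate Aff_U_group
    (insert (\<lambda>(w, z). (complex_of_real \<alpha> * w, - z)) (heis a b c r))"

definition type_II :: "(complex \<times> complex \<Rightarrow> complex \<times> complex) set \<Rightarrow> bool" where
  "type_II \<Gamma> \<longleftrightarrow>
    (\<exists>(\<theta>::int) \<alpha> (a :: real ^ 2) b N c r t. \<theta> \<ge> 3 \<and>
      \<alpha> = (of_int \<theta> + sqrt ((of_int \<theta>)\<^sup>2 - 4)) / 2 \<and>
      a \<noteq> b \<and> independent {a, b} \<and>
      N = conj_matrix a b \<alpha> (inverse \<alpha>) \<and> integral_matrix N \<and>
      r \<ge> 1 \<and>
      (\<exists>m. (\<forall>i. m $ i \<in> \<int>) \<and>
        (mat 1 - N) *v (c - (1/2) *\<^sub>R vector [a $ 1 * b $ 1, a $ 2 * b $ 2])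
          - (b \<and>\<^sub>w a / 2) *\<^sub>R vector [N $ 1 $ 1 * N $ 1 $ 2, N $ 2 $ 1 * N $ 2 $ 2]
        = (b \<and>\<^sub>w a / real r) *\<^sub>R m) \<and>
      \<Gamma> = G2 \<alpha> a b c r t)"

definition type_III :: "(complex \<times> complex \<Rightarrow> complex \<times> complex) set \<Rightarrow> bool" where
  "type_III \<Gamma> \<longleftrightarrow>
    (\<exists>(\<theta>::nat) \<alpha> (a :: real ^ 2) b N c r. \<theta> \<ge> 1 \<and>
      \<alpha> = (real \<theta> + sqrt ((real \<theta>)\<^sup>2 + 4)) / 2 \<and>
      a \<noteq> b \<and> independent {a, b} \<and>
      N = conj_matrix a b \<alpha> (- inverse \<alpha>) \<and> integral_matrix N \<and>
      r \<ge> 1 \<and>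
      (\<exists>m. (\<forall>i. m $ i \<in> \<int>) \<and>
        (mat 1 + N) *v (c - (1/2) *\<^sub>R vector [a $ 1 * b $ 1, a $ 2 * b $ 2])
          - (a \<and>\<^sub>w b / 2) *\<^sub>R vector [N $ 1 $ 1 * N $ 1 $ 2, N $ 2 $ 1 * N $ 2 $ 2]
        = (a \<and>\<^sub>w b / real r) *\<^sub>R m) \<and>
      \<Gamma> = G3 \<alpha> a b c r)"

definition inoue_group :: "(complex \<times> complex \<Rightarrow> complex \<times> complex) set \<Rightarrow> bool" where
  "inoue_group \<Gamma> \<longleftrightarrow> type_I \<Gamma> \<or> type_II \<Gamma> \<or> type_III \<Gamma>"

text \<open>All generators lie in the carrier of the ambient group, so that \<open>generate\<close> does produce
  the subgroup generated by them.\<close>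

lemma Aff_U_memI:
  assumes "k > 0" "m22 \<noteq> 0"
  shows "(\<lambda>(w, z). (complex_of_real k * w + complex_of_real x, m21 * w + m22 * z + v)) \<in> Aff_U"
    (is "?F \<in> _")
proof -
  have "?F = (\<lambda>(w, z). (complex_of_real k * w + 0 * z + complex_of_real x, m21 * w + m22 * z + v))"
    by simp
  moreover have "complex_of_real k * m22 - 0 * m21 \<noteq> 0" using assms by simp
  ultimately have "affine_transformation ?F"
    unfolding affine_transformation_def by blast
  moreover have "?F ` U = U"
  proof
    show "?F ` U \<subseteq> U" using assms by (auto simp: U_def upper_half_def)
    show "U \<subseteq> ?F ` U"
    proof
      fix y assume "y \<in> U"
      moreover obtain w z where y: "y = (w, z)" by (cases y)
      ultimately have "Im w > 0" by (simp add: U_def upper_half_def)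
      define w' where "w' = (w - complex_of_real x) / complex_of_real k"
      have "(w', (z - v - m21 * w') / m22) \<in> U"
        using \<open>Im w > 0\<close> assms by (simp add: U_def upper_half_def w'_def Im_divide_of_real)
      moreover have "y = ?F (w', (z - v - m21 * w') / m22)"
        using assms by (simp add: y w'_def)
      ultimately show "y \<in> ?F ` U" by (rule rev_image_eqI)
    qed
  qed
  ultimately show ?thesis by (simp add: Aff_U_def)
qed

lemma heis_subset: "heis a b c r \<subseteq> Aff_U"
  using Aff_U_memI[of 1 1 0 0] Aff_U_memI[of 1 1]
  by (fastforce simp: heis_def add_ac)

lemma inoue_group_subgroup:
  assumes "inoue_group \<Gamma>"
  shows "subgroup \<Gamma> Aff_U_group"
proof -
  interpret group Aff_U_group by (rule group_Aff_U)
  have G1: "subgroup (G1 \<beta> a b) Aff_U_group" if "\<beta> \<notin> \<real>" for \<beta> a b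
  proof -
    from that have "\<beta> \<noteq> 0" by auto
    then have "(\<lambda>(w, z). (complex_of_real (cmod \<beta> powi (-2)) * w, \<beta> * z)) \<in> Aff_U"
      using Aff_U_memI[of "cmod \<beta> powi (-2)" \<beta> 0 0 0] by simp
    moreover have "(\<lambda>(w, z). (w + complex_of_real (a $ i), z + b $ i)) \<in> Aff_U" for i
      using Aff_U_memI[of 1 1 "a $ i" 0 "b $ i"] by simp
    ultimately show ?thesis
      unfolding G1_def by (intro generate_is_subgroup) (auto simp: Aff_U_group_def)
  qed
  have G2: "subgroup (G2 \<alpha> a b c r t) Aff_U_group" if "\<alpha> > 0" for \<alpha> a b c r t
    unfolding G2_def using heis_subset[of a b c r] Aff_U_memI[OF that, of 1 0 0 t]
    by (intro generate_is_subgroup) (auto simp: Aff_U_group_def)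
  have G3: "subgroup (G3 \<alpha> a b c r) Aff_U_group" if "\<alpha> > 0" for \<alpha> a b c r
    unfolding G3_def using heis_subset[of a b c r] Aff_U_memI[OF that, of "-1" 0 0 0]
    by (intro generate_is_subgroup) (auto simp: Aff_U_group_def)
  have a2: "(of_int \<theta> + sqrt ((of_int \<theta>)\<^sup>2 - 4)) / 2 > (0::real)" if "\<theta> \<ge> 3" for \<theta> :: int
  proof -
    have "(of_int \<theta> :: real) \<ge> 3" using that by simp
    then have "(of_int \<theta> :: real)\<^sup>2 \<ge> 3\<^sup>2" by (intro power_mono) auto
    then have "sqrt ((of_int \<theta>)\<^sup>2 - 4) \<ge> 0" by simp
    with \<open>(of_int \<theta> :: real) \<ge> 3\<close> show ?thesis
      by (intro divide_pos_pos add_pos_nonneg) auto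
  qed
  have a3: "(real \<theta> + sqrt ((real \<theta>)\<^sup>2 + 4)) / 2 > 0" for \<theta>
    by (intro divide_pos_pos add_nonneg_pos) (auto simp: add_nonneg_pos)
  from assms consider "type_I \<Gamma>" | "type_II \<Gamma>" | "type_III \<Gamma>"
    by (auto simp: inoue_group_def)
  then show ?thesis
  proof cases
    case 1
    then show ?thesis using G1
      by (auto simp: type_I_def admissible_def)
  next
    case 2
    then obtain \<theta> :: int and \<alpha> a b c r t where "\<theta> \<ge> 3"
      "\<alpha> = (of_int \<theta> + sqrt ((of_int \<theta>)\<^sup>2 - 4)) / 2" "\<Gamma> = G2 \<alpha> a b c r t"
      unfolding type_II_def by blast
    with G2 a2 show ?thesis by metis
  next
    case 3
    then obtain \<theta> :: nat and \<alpha> a b c r where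
      "\<alpha> = (real \<theta> + sqrt ((real \<theta>)\<^sup>2 + 4)) / 2" "\<Gamma> = G3 \<alpha> a b c r"
      unfolding type_III_def by blast
    with G3 a3 show ?thesis by metis
  qed
qed

section \<open>Holomorphic maps and quotients\<close>

text \<open>Complex differentiability of maps in two complex variables: the real (Frechet) derivative
  is complex linear.  Intended for open \<open>D\<close>.\<close>

definition holomorphic2_on :: "(complex \<times> complex \<Rightarrow> complex \<times> complex) \<Rightarrow> (complex \<times> complex) set \<Rightarrow> bool"
    (infixl \<open>holomorphic2'_on\<close> 50) where
  "F holomorphic2_on D \<longleftrightarrow>
    (\<forall>x\<in>D. \<exists>F'. (F has_derivative F') (at x within D) \<and>
      (\<forall>k u v. F' (k * u, k * v) = (k * fst (F' (u, v)), k * snd (F' (u, v)))))"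

definition biholomorphic2 ::
    "(complex \<times> complex \<Rightarrow> complex \<times> complex) \<Rightarrow> (complex \<times> complex) set \<Rightarrow> (complex \<times> complex) set \<Rightarrow> bool" where
  "biholomorphic2 F D E \<longleftrightarrow>
    bij_betw F D E \<and> F holomorphic2_on D \<and> inv_into D F holomorphic2_on E"

text \<open>Points of \<open>U/\<Gamma>\<close> are the orbits, and \<open>proj \<Gamma>\<close> is the canonical projection.\<close>

definition proj :: "(complex \<times> complex \<Rightarrow> complex \<times> complex) set \<Rightarrow> complex \<times> complex \<Rightarrow> (complex \<times> complex) set" where
  "proj \<Gamma> x = {\<gamma> x | \<gamma>. \<gamma> \<in> \<Gamma>}"

definition quot :: "(complex \<times> complex \<Rightarrow> complex \<times> complex) set \<Rightarrow> (complex \<times> complex) set set" where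
  "quot \<Gamma> = proj \<Gamma> ` U"

definition quot_top :: "(complex \<times> complex \<Rightarrow> complex \<times> complex) set \<Rightarrow> (complex \<times> complex) set topology" where
  "quot_top \<Gamma> = topology (\<lambda>T. T \<subseteq> quot \<Gamma> \<and> open {x \<in> U. proj \<Gamma> x \<in> T})"

lemma openin_quot_top:
  "openin (quot_top \<Gamma>) T \<longleftrightarrow> T \<subseteq> quot \<Gamma> \<and> open {x \<in> U. proj \<Gamma> x \<in> T}"
proof -
  have "istopology (\<lambda>T. T \<subseteq> quot \<Gamma> \<and> open {x \<in> U. proj \<Gamma> x \<in> T})"
    unfolding istopology_def
  proof (intro conjI allI impI)
    fix S T
    assume "S \<subseteq> quot \<Gamma> \<and> open {x \<in> U. proj \<Gamma> x \<in> S}" "T \<subseteq> quot \<Gamma> \<and> open {x \<in> U. proj \<Gamma> x \<in> T}"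
    moreover have "{x \<in> U. proj \<Gamma> x \<in> S \<inter> T} = {x \<in> U. proj \<Gamma> x \<in> S} \<inter> {x \<in> U. proj \<Gamma> x \<in> T}"
      by auto
    ultimately show "S \<inter> T \<subseteq> quot \<Gamma>" "open {x \<in> U. proj \<Gamma> x \<in> S \<inter> T}" by auto
  next
    fix \<K>
    assume *: "\<forall>T\<in>\<K>. T \<subseteq> quot \<Gamma> \<and> open {x \<in> U. proj \<Gamma> x \<in> T}"
    have "{x \<in> U. proj \<Gamma> x \<in> \<Union>\<K>} = (\<Union>T\<in>\<K>. {x \<in> U. proj \<Gamma> x \<in> T})" by auto
    with * show "\<Union>\<K> \<subseteq> quot \<Gamma>" "open {x \<in> U. proj \<Gamma> x \<in> \<Union>\<K>}" by auto
  qed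
  then show ?thesis by (simp add: quot_top_def topology_inverse')
qed

text \<open>The complex structure on \<open>U/\<Gamma>\<close>: its charts are the local inverses
  \<open>inv_into V (proj \<Gamma>) : proj \<Gamma> ` V \<rightarrow> V\<close> of the projection, for open \<open>V \<subseteq> U\<close> on which
  \<open>proj \<Gamma>\<close> is injective.\<close>

definition chart_domain :: "(complex \<times> complex \<Rightarrow> complex \<times> complex) set \<Rightarrow> (complex \<times> complex) set \<Rightarrow> bool" where
  "chart_domain \<Gamma> V \<longleftrightarrow> open V \<and> V \<subseteq> U \<and> inj_on (proj \<Gamma>) V"

definition quot_holomorphic ::
    "(complex \<times> complex \<Rightarrow> complex \<times> complex) set \<Rightarrow> (complex \<times> complex \<Rightarrow> complex \<times> complex) set \<Rightarrow>
     ((complex \<times> complex) set \<Rightarrow> (complex \<times> complex) set) \<Rightarrow> bool" where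
  "quot_holomorphic \<Gamma>' \<Gamma>'' f \<longleftrightarrow>
    continuous_map (quot_top \<Gamma>') (quot_top \<Gamma>'') f \<and>
    (\<forall>V W. chart_domain \<Gamma>' V \<longrightarrow> chart_domain \<Gamma>'' W \<longrightarrow>
      (inv_into W (proj \<Gamma>'') \<circ> f \<circ> proj \<Gamma>')
        holomorphic2_on {x \<in> V. f (proj \<Gamma>' x) \<in> proj \<Gamma>'' ` W})"

definition quot_biholomorphic ::
    "(complex \<times> complex \<Rightarrow> complex \<times> complex) set \<Rightarrow> (complex \<times> complex \<Rightarrow> complex \<times> complex) set \<Rightarrow>
     ((complex \<times> complex) set \<Rightarrow> (complex \<times> complex) set) \<Rightarrow> bool" where
  "quot_biholomorphic \<Gamma>' \<Gamma>'' f \<longleftrightarrow>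
    bij_betw f (quot \<Gamma>') (quot \<Gamma>'') \<and> quot_holomorphic \<Gamma>' \<Gamma>'' f \<and>
    quot_holomorphic \<Gamma>'' \<Gamma>' (inv_into (quot \<Gamma>') f)"

end

theory Submission
  imports Defs "HOL-Complex_Analysis.Complex_Analysis"
    "HOL-Computational_Algebra.Fundamental_Theorem_Algebra"
begin

text \<open>Liouville's theorem makes the first component of the lift independent of \<open>z\<close>, and as an
  injective entire function is affine, the lift has the form \<open>(w, z) \<mapsto> (h w, A w * z + B w)\<close>.
  It conjugates each element of \<open>\<Gamma>'\<close> to an element of \<open>\<Gamma>''\<close>. Apply this to one element
  \<open>(w, z) \<mapsto> (l * w, \<delta> * z + t)\<close> with \<open>l > 1 \<ge> \<bar>\<delta>\<bar>\<close> and to one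
  \<open>(w, z) \<mapsto> (w + a, z + b * w + c)\<close> with \<open>a \<noteq> 0\<close>: the functions \<open>h'\<close>, \<open>A\<close> and, once these are
  known to be constant, \<open>B''\<close> are multiplied by constants under \<open>w \<mapsto> l * w\<close> and \<open>w \<mapsto> w + a\<close>. Such a
  function has arbitrarily small periods, hence is constant. Finally the scaling
  multiplies \<open>B''\<close> by \<open>\<delta> / l\<^sup>2 \<noteq> 1\<close>, so that \<open>B'' = 0\<close>.\<close>

section \<open>Holomorphic functions of one variable\<close>

text \<open>The inverse is entire, so preimages of compact sets are compact and \<open>f\<close> is
  proper, hence a polynomial. Injectivity leaves its derivative without zeros, so the derivative is
  constant by the fundamental theorem of algebra.\<close>

lemma bij_entire_imp_affine:
  fixes f :: "complex \<Rightarrow> complex"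
  assumes hol: "f holomorphic_on UNIV" and bij: "bij f"
  obtains a b where "a \<noteq> 0" "\<And>z. f z = a * z + b"
proof -
  have inj: "inj f" using bij by (simp add: bij_def)
  obtain g where g: "g holomorphic_on UNIV" "\<And>z. g (f z) = z"
    using holomorphic_has_inverse[OF hol open_UNIV inj] bij by (metis UNIV_I bij_is_surj)
  have fg: "f (g y) = y" for y using g(2) bij by (metis bij_pointE)
  have "compact {z. f z \<in> K}" if "compact K" for K
  proof -
    have "{z. f z \<in> K} = g ` K" using g(2) fg by (auto simp: image_iff) metis
    then show ?thesis
      using compact_continuous_image[OF _ that, of g] g(1)
      by (metis continuous_on_subset holomorphic_on_imp_continuous_on subset_UNIV)
  qed
  then obtain c n where f: "f = (\<lambda>z. \<Sum>i\<le>n. c i * z ^ i)"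
    using proper_map_polyfun_eq[OF hol] by blast
  define p where "p = (\<Sum>i\<le>n. monom (c i) i)"
  have fp: "f = poly p" by (simp add: fun_eq_iff f p_def poly_sum poly_monom)
  have "poly (pderiv p) z \<noteq> 0" for z
    using holomorphic_injective_imp_regular[OF hol open_UNIV inj, of z]
      DERIV_imp_deriv[OF poly_DERIV[of p z]]
    by (simp add: fp)
  then have const: "constant (poly (pderiv p))"
    using Fundamental_Theorem_Algebra.fundamental_theorem_of_algebra[of "pderiv p"] by auto
  define a where "a = poly (pderiv p) 0"
  have a: "poly (pderiv p) z = a" for z
    using const[unfolded constant_def, rule_format, of z 0] by (simp add: a_def)
  have "((\<lambda>z. f z - a * z) has_field_derivative 0) (at z)" for z
    using DERIV_diff[OF poly_DERIV[of p z] DERIV_cmult_Id[of a]]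
    by (simp add: fp a)
  then obtain b where "\<And>z. f z - a * z = b"
    using has_field_derivative_zero_constant[OF convex_UNIV, of "\<lambda>z. f z - a * z"] by auto
  then have f': "f z = a * z + b" for z by (metis add.commute diff_add_cancel)
  moreover have "f 0 \<noteq> f 1" using injD[OF inj, of 0 1] by auto
  then have "a \<noteq> 0" using f' by auto
  ultimately show thesis using that by blast
qed

text \<open>Values in the upper half plane stay at distance at least 1 from \<open>-\<i>\<close>, so
  \<open>inverse (f z + \<i>)\<close> is a bounded entire function.\<close>

lemma entire_upper_half_constant:
  assumes hol: "f holomorphic_on UNIV" and im: "\<And>z. f z \<in> upper_half"
  shows "f x = f y"
proof -
  have pos: "Im (f z) > 0" for z using im by (simp add: upper_half_def)
  have ge: "cmod (f z + \<i>) \<ge> 1" for z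
    using abs_Im_le_cmod[of "f z + \<i>"] pos[of z] by simp
  have nz: "f z + \<i> \<noteq> 0" for z using ge[of z] by auto
  have "(\<lambda>z. inverse (f z + \<i>)) holomorphic_on UNIV"
    using nz by (intro holomorphic_intros hol) auto
  moreover have "bounded (range (\<lambda>z. inverse (f z + \<i>)))"
    unfolding bounded_iff using ge
    by (intro exI[of _ 1]) (auto simp: norm_inverse intro: inverse_le_1_iff[THEN iffD2])
  ultimately have "(\<lambda>z. inverse (f z + \<i>)) constant_on UNIV" by (rule Liouville_theorem)
  then have "inverse (f x + \<i>) = inverse (f y + \<i>)" unfolding constant_on_def by (metis UNIV_I)
  then show ?thesis by simp
qed

lemma upper_half_open: "open upper_half"
  unfolding upper_half_def by (rule open_halfspace_Im_gt)

lemma upper_half_convex: "convex upper_half"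
  unfolding upper_half_def by (rule convex_halfspace_Im_gt)

lemma upper_half_connected: "connected upper_half"
  by (rule convex_connected[OF upper_half_convex])

lemma i_in_upper_half: "\<i> \<in> upper_half"
  by (simp add: upper_half_def)

lemma upper_half_affine:
  assumes "l > 0" "w \<in> upper_half"
  shows "complex_of_real l * w + complex_of_real a \<in> upper_half"
  using assms by (simp add: upper_half_def)

lemma uncountable_upper_half: "uncountable upper_half"
  by (rule connected_uncountable[OF upper_half_connected i_in_upper_half, of "2 * \<i>"])
     (simp_all add: upper_half_def)

lemma upper_half_deriv_constant:
  assumes hol: "f holomorphic_on upper_half" and d: "\<And>w. w \<in> upper_half \<Longrightarrow> deriv f w = k"
  obtains c where "\<And>w. w \<in> upper_half \<Longrightarrow> f w = k * w + c"
proof -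
  have "((\<lambda>w. f w - k * w) has_field_derivative 0) (at w within upper_half)" if "w \<in> upper_half" for w
  proof -
    have "(f has_field_derivative k) (at w)"
      using holomorphic_derivI[OF hol upper_half_open that, of UNIV] d[OF that] by simp
    from DERIV_diff[OF this DERIV_cmult_Id[of k]]
    have "((\<lambda>w. f w - k * w) has_field_derivative 0) (at w)" by simp
    then show ?thesis by (rule has_field_derivative_at_within)
  qed
  then have "\<exists>c. \<forall>w\<in>upper_half. f w - k * w = c"
    by (rule has_field_derivative_zero_constant[OF upper_half_convex])
  then obtain c where "\<And>w. w \<in> upper_half \<Longrightarrow> f w - k * w = c" by blast
  then have "f w = k * w + c" if "w \<in> upper_half" for w
    using that by (metis add.commute diff_add_cancel)
  then show thesis by (rule that)
qed

text \<open>The chain rule divides the multiplier \<open>p\<close> by \<open>l\<close> and lowers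
  the degree of the inhomogeneous part \<open>q * w + v\<close>. One application thus makes the
  relation for \<open>h\<close> homogeneous; two applications do so for \<open>B\<close>.\<close>

lemma deriv_affine_relation:
  fixes l a :: real
  assumes hol: "f holomorphic_on upper_half" and l: "l > 0"
    and eq: "\<And>w. w \<in> upper_half \<Longrightarrow> f (of_real l * w + of_real a) = p * f w + q * w + v"
    and w: "w \<in> upper_half"
  shows "deriv f (of_real l * w + of_real a) = p / of_real l * deriv f w + q / of_real l"
proof -
  have "((\<lambda>w. complex_of_real l * w + complex_of_real a) has_field_derivative complex_of_real l + 0) (at w)"
    by (intro DERIV_add DERIV_cmult_Id DERIV_const)
  from DERIV_chain2[of f, OF holomorphic_derivI[OF hol upper_half_open upper_half_affine[OF l w, of a]] this]
  have "((\<lambda>w. f (of_real l * w + of_real a)) has_field_derivative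
      deriv f (of_real l * w + of_real a) * of_real l) (at w)"
    by (simp only: add_0_right)
  moreover have "((\<lambda>w. f (of_real l * w + of_real a)) has_field_derivative p * deriv f w + q) (at w)"
  proof (rule has_field_derivative_transform_within_open[OF _ upper_half_open w])
    have "((\<lambda>w. p * f w + q * w + v) has_field_derivative p * deriv f w + q + 0) (at w)"
      by (intro DERIV_add DERIV_cmult DERIV_cmult_Id DERIV_const
            holomorphic_derivI[OF hol upper_half_open w])
    then show "((\<lambda>w. p * f w + q * w + v) has_field_derivative p * deriv f w + q) (at w)"
      by (simp only: add_0_right)
  qed (simp add: eq)
  ultimately have "deriv f (of_real l * w + of_real a) * of_real l = p * deriv f w + q"
    by (rule DERIV_unique)
  moreover have "complex_of_real l \<noteq> 0" using l by simp
  ultimately show ?thesis by (metis add_divide_distrib nonzero_mult_div_cancel_right times_divide_eq_left)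
qed

text \<open>The scaling turns the period \<open>s\<close> into the periods \<open>s / l ^ n\<close>, which accumulate at \<open>0\<close>.\<close>

lemma periodic_scaling_constant:
  fixes l s :: real
  assumes hol: "g holomorphic_on upper_half" and l: "l > 1" and s: "s \<noteq> 0" and "\<mu> \<noteq> 0"
    and scale: "\<And>w. w \<in> upper_half \<Longrightarrow> g (of_real l * w) = \<mu> * g w"
    and period: "\<And>w. w \<in> upper_half \<Longrightarrow> g (w + of_real s) = g w"
  obtains c where "\<And>w. w \<in> upper_half \<Longrightarrow> g w = c"
proof -
  have period': "g (w + of_real (s / l ^ n)) = g w" if "w \<in> upper_half" for w n
    using that
  proof (induction n arbitrary: w)
    case 0
    then show ?case using period by simp
  next
    case (Suc n)
    let ?v = "w + of_real (s / l ^ Suc n)"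
    have v: "?v \<in> upper_half" using Suc.prems by (simp add: upper_half_def)
    have lw: "of_real l * w \<in> upper_half" using Suc.prems l by (simp add: upper_half_def)
    have "of_real l * ?v = of_real l * w + of_real (s / l ^ n)"
      using l by (simp add: field_simps)
    then have "\<mu> * g ?v = g (of_real l * w + of_real (s / l ^ n))"
      using scale[OF v] by simp
    also have "\<dots> = \<mu> * g w" using Suc.IH[OF lw] scale[OF Suc.prems] by simp
    finally show ?case using \<open>\<mu> \<noteq> 0\<close> by simp
  qed
  define t where "t n = \<i> + complex_of_real (s / l ^ n)" for n
  have "(\<lambda>n. s / l ^ n) \<longlonglongrightarrow> 0"
    using l by (rule LIMSEQ_divide_realpow_zero)
  then have "t \<longlonglongrightarrow> \<i> + complex_of_real 0"
    unfolding t_def by (intro tendsto_intros)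
  then have lim: "t \<longlonglongrightarrow> \<i>" by simp
  \<comment> \<open>As \<open>s\<close> is nonzero, the sequence avoids its limit, so
    \<open>\<i>\<close> is a genuine accumulation point, as the identity theorem requires.\<close>
  have "\<forall>n. t n \<in> range t - {\<i>}" using s l by (auto simp: t_def)
  with lim have "\<i> islimpt range t" unfolding islimpt_sequential by blast
  moreover have "range t \<subseteq> upper_half" by (auto simp: t_def upper_half_def)
  moreover have "g constant_on range t"
    unfolding constant_on_def t_def using period'[OF i_in_upper_half] by auto
  ultimately have "g constant_on upper_half"
    using analytic_continuation'[OF hol upper_half_open upper_half_connected _ i_in_upper_half] by blast
  then show thesis using that by (auto simp: constant_on_def)
qed

text \<open>Supplies the sigma-compactness through which isolated zeros become countably
  many.\<close>

lemma open_imp_fsigma: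
  fixes S :: "'a::euclidean_space set"
  assumes "open S"
  shows "fsigma S"
proof (rule open_Union_compact_subsets[OF assms])
  fix C :: "nat \<Rightarrow> 'a set"
  assume C: "\<And>n. compact (C n)" "\<Union> (range C) = S"
  have "range C \<subseteq> Collect compact \<and> S = \<Union> (range C)"
    by (rule conjI) (use C(1) in \<open>fast\<close>, rule C(2)[symmetric])
  then show "fsigma S" unfolding fsigma_Union_compact by (rule exI[of _ C])
qed

text \<open>The identity theorem in the form that fits a pigeonhole argument: a holomorphic function
  that is not identically zero on a connected open set has isolated, hence only countably many,
  zeros.\<close>

lemma uncountable_zeros_imp_zero:
  assumes "f holomorphic_on S" "open S" "connected S" "Z \<subseteq> S" "uncountable Z"
    and "\<And>z. z \<in> Z \<Longrightarrow> f z = 0" and "w \<in> S"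
  shows "f w = 0"
proof -
  have "Z \<subseteq> {z\<in>S. f z = 0}" using assms(4,6) by auto
  then have "uncountable {z\<in>S. f z = 0}" using assms(5) by (metis countable_subset)
  then have "S \<subseteq> {z\<in>S. f z = 0}"
    using holomorphic_countable_equal[of f S "\<lambda>_. 0"] assms(1-3) open_imp_fsigma[OF assms(2)] by simp
  then show ?thesis using assms(7) by blast
qed

section \<open>Slices of maps in two variables\<close>

lemma U_open: "open U"
  unfolding U_def by (intro open_Times upper_half_open open_UNIV)

lemma U_iff [simp]: "(w, z) \<in> U \<longleftrightarrow> w \<in> upper_half"
  by (simp add: U_def)

text \<open>The map is restricted to the complex line through \<open>(c, d)\<close> with direction
  \<open>(a, b)\<close>, along which a complex linear derivative reduces to a complex number in each
  component. The directions \<open>(0, 1)\<close> and \<open>(1, 0)\<close> give the coordinate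
  slices.\<close>

lemma holomorphic2_on_compose_slice:
  assumes F: "F holomorphic2_on D" and "open D"
    and sl: "\<And>x. x \<in> S \<Longrightarrow> (a * x + c, b * x + d) \<in> D"
  shows "(\<lambda>x. fst (F (a * x + c, b * x + d))) holomorphic_on S"
    and "(\<lambda>x. snd (F (a * x + c, b * x + d))) holomorphic_on S"
proof -
  have *: "\<exists>F'. ((\<lambda>x. F (a * x + c, b * x + d)) has_derivative (\<lambda>h. F' (a * h, b * h))) (at x) \<and>
      (\<forall>k u v. F' (k * u, k * v) = (k * fst (F' (u, v)), k * snd (F' (u, v))))" if x: "x \<in> S" for x
  proof -
    from F sl[OF x] obtain F' where F': "(F has_derivative F') (at (a * x + c, b * x + d))"
      "\<forall>k u v. F' (k * u, k * v) = (k * fst (F' (u, v)), k * snd (F' (u, v)))"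
      unfolding holomorphic2_on_def using \<open>open D\<close> by (metis at_within_open)
    have aff: "((\<lambda>x. a * x + c) has_derivative (\<lambda>h. a * h)) (at x)" for a c :: complex
      using DERIV_add[OF DERIV_cmult_Id[of a x UNIV] DERIV_const[of c]]
      by (simp add: has_field_derivative_def)
    have "((\<lambda>x. (a * x + c, b * x + d)) has_derivative (\<lambda>h. (a * h, b * h))) (at x)"
      by (rule has_derivative_Pair[OF aff aff])
    from conjI[OF has_derivative_compose[OF this F'(1)] F'(2)] show ?thesis by (rule exI[of _ F'])
  qed
  have "(\<lambda>x. fst (F (a * x + c, b * x + d))) field_differentiable at x \<and>
      (\<lambda>x. snd (F (a * x + c, b * x + d))) field_differentiable at x" if x: "x \<in> S" for x
  proof -
    from *[OF x] obtain F' where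
      F': "((\<lambda>x. F (a * x + c, b * x + d)) has_derivative (\<lambda>h. F' (a * h, b * h))) (at x) \<and>
        (\<forall>k u v. F' (k * u, k * v) = (k * fst (F' (u, v)), k * snd (F' (u, v))))" by (rule exE)
    \<comment> \<open>Homogeneity with the increment \<open>h\<close> as the scalar shows that the
      components of \<open>F' (a, b)\<close> are the derivatives along the slice.\<close>
    have hom: "F' (a * h, b * h) = (h * fst (F' (a, b)), h * snd (F' (a, b)))" for h
      using F'[THEN conjunct2, rule_format, of h a b] by (simp add: mult.commute)
    have "((\<lambda>x. fst (F (a * x + c, b * x + d))) has_field_derivative fst (F' (a, b))) (at x)"
      by (rule has_derivative_imp_has_field_derivative[OF has_derivative_fst[OF F'[THEN conjunct1]]])
         (simp add: hom)
    moreover have "((\<lambda>x. snd (F (a * x + c, b * x + d))) has_field_derivative snd (F' (a, b))) (at x)"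
      by (rule has_derivative_imp_has_field_derivative[OF has_derivative_snd[OF F'[THEN conjunct1]]])
         (simp add: hom)
    ultimately show ?thesis unfolding field_differentiable_def by (intro conjI exI)
  qed
  then show "(\<lambda>x. fst (F (a * x + c, b * x + d))) holomorphic_on S"
    "(\<lambda>x. snd (F (a * x + c, b * x + d))) holomorphic_on S"
    unfolding holomorphic_on_def using field_differentiable_at_within by blast+
qed

lemma holomorphic2_on_U_slices:
  assumes "F holomorphic2_on U"
  shows "w \<in> upper_half \<Longrightarrow> (\<lambda>z. fst (F (w, z))) holomorphic_on UNIV"
    and "w \<in> upper_half \<Longrightarrow> (\<lambda>z. snd (F (w, z))) holomorphic_on UNIV"
    and "(\<lambda>w. fst (F (w, z))) holomorphic_on upper_half"
    and "(\<lambda>w. snd (F (w, z))) holomorphic_on upper_half"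
  using holomorphic2_on_compose_slice[OF assms U_open, of UNIV 0 w 1 0]
    holomorphic2_on_compose_slice[OF assms U_open, of upper_half 1 0 0 z]
  by simp_all

lemma fst_constant_on_fibres:
  assumes "F holomorphic2_on U" "F ` U \<subseteq> U" "w \<in> upper_half"
  shows "fst (F (w, z)) = fst (F (w, z'))"
proof -
  have "fst (F (w, z)) \<in> upper_half" for z
    using assms(2,3) by (metis U_iff image_subset_iff prod.collapse)
  then show ?thesis
    by (intro entire_upper_half_constant[of "\<lambda>z. fst (F (w, z))"] holomorphic2_on_U_slices assms)
qed

text \<open>Both \<open>F\<close> and its inverse respect the fibres over \<open>w\<close>, so
  \<open>F\<close> maps the fibre over \<open>w\<close> bijectively to the one over
  \<open>h w\<close> and is affine there. The coefficients are read off at \<open>z = 0\<close> and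
  \<open>z = 1\<close>, which makes them holomorphic in \<open>w\<close>.\<close>

lemma biholomorphic_U_form:
  assumes bi: "biholomorphic2 F U U"
  obtains h A B where
    "h holomorphic_on upper_half" "A holomorphic_on upper_half" "B holomorphic_on upper_half"
    "inj_on h upper_half" "\<And>w. w \<in> upper_half \<Longrightarrow> h w \<in> upper_half"
    "\<And>w. w \<in> upper_half \<Longrightarrow> A w \<noteq> 0"
    "\<And>w z. w \<in> upper_half \<Longrightarrow> F (w, z) = (h w, A w * z + B w)"
proof -
  define G where "G = inv_into U F"
  have bij: "bij_betw F U U" and F: "F holomorphic2_on U" and G: "G holomorphic2_on U"
    using bi by (auto simp: biholomorphic2_def G_def)
  have FU: "F ` U = U" and inj: "inj_on F U" using bij by (auto simp: bij_betw_def)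
  have GU: "G ` U = U" using bij_betw_inv_into[OF bij] by (simp add: G_def bij_betw_def)
  have GF: "G (F x) = x" if "x \<in> U" for x using inj that by (simp add: G_def)
  have FG: "F (G x) = x" if "x \<in> U" for x using FU that by (simp add: G_def f_inv_into_f)
  define h where "h w = fst (F (w, 0))" for w
  define A where "A w = snd (F (w, 1)) - snd (F (w, 0))" for w
  define B where "B w = snd (F (w, 0))" for w
  have Fh: "fst (F (w, z)) = h w" if "w \<in> upper_half" for w z
    unfolding h_def using fst_constant_on_fibres[OF F _ that] FU by blast
  have hH: "h w \<in> upper_half" if "w \<in> upper_half" for w
    using FU that unfolding h_def by (metis U_iff imageI prod.collapse)
  \<comment> \<open>The first component of \<open>G\<close> is constant on the fibre over
    \<open>h w\<close>, so it may be evaluated at \<open>F (w, 0)\<close>, which lies in that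
    fibre.\<close>
  have Gh: "fst (G (h w, z)) = w" if w: "w \<in> upper_half" for w z
  proof -
    have "fst (G (h w, z)) = fst (G (h w, snd (F (w, 0))))"
      using fst_constant_on_fibres[OF G _ hH[OF w]] GU by blast
    also have "\<dots> = fst (G (F (w, 0)))" by (simp add: h_def)
    finally show ?thesis using GF w by simp
  qed
  have aff: "A w \<noteq> 0 \<and> F (w, z) = (h w, A w * z + B w)" if w: "w \<in> upper_half" for w z
  proof -
    have "inj (\<lambda>z. snd (F (w, z)))"
    proof (rule injI)
      fix x y assume "snd (F (w, x)) = snd (F (w, y))"
      then have "F (w, x) = F (w, y)" using Fh[OF w] by (simp add: prod_eq_iff)
      then show "x = y" using inj w by (auto dest: inj_onD)
    qed
    moreover have "surj (\<lambda>z. snd (F (w, z)))"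
    proof (rule surjI)
      fix y
      have "G (h w, y) = (w, snd (G (h w, y)))" using Gh[OF w] by (simp add: prod_eq_iff)
      then show "snd (F (w, snd (G (h w, y)))) = y" using FG[of "(h w, y)"] hH[OF w] by simp
    qed
    ultimately have "bij (\<lambda>z. snd (F (w, z)))" by (simp add: bij_def)
    then obtain a b where ab: "a \<noteq> 0" "\<And>z. snd (F (w, z)) = a * z + b"
      using bij_entire_imp_affine[OF holomorphic2_on_U_slices(2)[OF F w]] by blast
    then have "A w = a" "B w = b" by (simp_all add: A_def B_def)
    with ab Fh[OF w] show ?thesis by (simp add: prod_eq_iff)
  qed
  have "h holomorphic_on upper_half" "A holomorphic_on upper_half" "B holomorphic_on upper_half"
    unfolding h_def A_def B_def by (intro holomorphic_intros holomorphic2_on_U_slices F)+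
  moreover have "inj_on h upper_half" by (metis Gh inj_onI)
  ultimately show thesis using that hH aff by blast
qed

section \<open>Inoue groups\<close>

text \<open>Every element is the product of a finite word in the generators and their inverses, and
  there are only countably many such words.\<close>

lemma (in group) countable_generate:
  assumes "countable S" "S \<subseteq> carrier G"
  shows "countable (generate G S)"
proof -
  let ?H = "S \<union> m_inv G ` S"
  let ?m = "\<lambda>xs. foldr (\<otimes>) xs \<one>"
  have H: "?H \<subseteq> carrier G" using assms(2) by auto
  have closed: "?m xs \<in> carrier G" if "xs \<in> lists ?H" for xs
    using that H by (induction xs) auto
  have append: "?m (xs @ ys) = ?m xs \<otimes> ?m ys" if "xs \<in> lists ?H" "ys \<in> lists ?H" for xs ys
    using that(1)
  proof (induction xs)
    case Nil
    then show ?case using closed[OF that(2)] by simp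
  next
    case (Cons x xs)
    then have "x \<in> carrier G" "?m xs \<in> carrier G" using H closed by auto
    with Cons closed[OF that(2)] show ?case by (simp add: m_assoc)
  qed
  have "g \<in> ?m ` lists ?H" if "g \<in> generate G S" for g
    using that
  proof induction
    case one
    then show ?case by (intro image_eqI[of _ _ "[]"]) auto
  next
    case (incl h)
    then show ?case using H by (intro image_eqI[of _ _ "[h]"]) auto
  next
    case (inv h)
    then show ?case using H by (intro image_eqI[of _ _ "[inv h]"]) auto
  next
    case (eng g h)
    then obtain xs ys where "xs \<in> lists ?H" "ys \<in> lists ?H" "g = ?m xs" "h = ?m ys" by blast
    then show ?case using append by (intro image_eqI[of _ _ "xs @ ys"]) auto
  qed
  moreover have "countable (?m ` lists ?H)" using assms(1) by auto
  ultimately show ?thesis by (auto intro: countable_subset)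
qed

text \<open>If the first component depended on \<open>z\<close>, it would take every complex value
  on the fibre over \<open>\<i>\<close>, among them \<open>-\<i>\<close>, whose imaginary part is
  negative.\<close>

lemma Aff_U_triangular:
  assumes "F \<in> Aff_U"
  obtains p u r s v where "p \<noteq> 0" "s \<noteq> 0" "\<And>w z. F (w, z) = (p * w + u, r * w + s * z + v)"
proof -
  obtain p q r s u v where F: "p * s - q * r \<noteq> 0"
    "F = (\<lambda>(w, z). (p * w + q * z + u, r * w + s * z + v))" and U: "F ` U = U"
    using assms unfolding Aff_U_def affine_transformation_def by blast
  have "q = 0"
  proof (rule ccontr)
    assume q: "q \<noteq> 0"
    have "F (\<i>, (- \<i> - p * \<i> - u) / q) \<in> U" using U i_in_upper_half by (metis U_iff imageI)
    moreover have "fst (F (\<i>, (- \<i> - p * \<i> - u) / q)) = - \<i>" using q by (simp add: F(2))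
    ultimately show False by (auto simp: U_def upper_half_def)
  qed
  with F show thesis using that[of p s u r v] by auto
qed

lemma countable_range_insert:
  fixes g :: "'i::finite \<Rightarrow> 'b"
  shows "countable (insert x {g i | i. True})"
  by (simp add: full_SetCompr_eq)

text \<open>Reduces the three types to common data. The factor \<open>\<delta>\<close> is
  \<open>\<beta>\<close>, \<open>1\<close> or \<open>-1\<close> for types I, II and III, and the
  translation belongs to a nonzero coordinate of \<open>a\<close>, which exists by linear
  independence. The bounds on \<open>l\<close> and \<open>\<delta>\<close> later exclude
  \<open>\<delta> = (of_real l)\<^sup>2\<close>.\<close>

lemma inoue_group_elements:
  assumes "inoue_group \<Gamma>"
  shows "countable \<Gamma>"
    and "\<exists>l \<delta> t. l > 1 \<and> \<delta> \<noteq> 0 \<and> cmod \<delta> \<le> 1 \<and> (\<lambda>(w, z). (complex_of_real l * w, \<delta> * z + t)) \<in> \<Gamma>"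
      (is ?scaling)
    and "\<exists>a b c. a \<noteq> 0 \<and> (\<lambda>(w, z). (w + complex_of_real a, z + b * w + c)) \<in> \<Gamma>" (is ?translation)
proof -
  interpret group Aff_U_group by (rule group_Aff_U)
  have sub: "\<Gamma> \<subseteq> Aff_U"
    using subgroup.subset[OF inoue_group_subgroup[OF assms]] by (simp add: Aff_U_group_def)
  have cnt: "countable \<Gamma>" if "\<Gamma> = generate Aff_U_group S" "countable S" for S
  proof -
    have "S \<subseteq> carrier Aff_U_group"
      using sub that(1) generate.incl[of _ S Aff_U_group] by (auto simp: Aff_U_group_def)
    then show ?thesis using countable_generate that by simp
  qed
  have cheis: "countable (heis a b c r)" for a b c r
    unfolding heis_def by (rule countable_range_insert)
  have heisI: "?translation" if "heis a b c r \<subseteq> \<Gamma>" and ind: "independent {a, b}" for a b c r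
  proof -
    have "a \<noteq> 0" using ind dependent_zero by blast
    then obtain i where "a $ i \<noteq> 0" by (auto simp: vec_eq_iff)
    moreover have "(\<lambda>(w, z). (w + complex_of_real (a $ i),
        z + complex_of_real (b $ i) * w + complex_of_real (c $ i))) \<in> \<Gamma>"
      using that(1) by (auto simp: heis_def)
    ultimately show ?thesis by blast
  qed
  from assms consider "type_I \<Gamma>" | "type_II \<Gamma>" | "type_III \<Gamma>" by (auto simp: inoue_group_def)
  then have "countable \<Gamma> \<and> ?scaling \<and> ?translation"
  proof cases
    case 1
    then obtain \<beta> a b where ad: "admissible \<beta>" and co: "compatible \<beta> a b" and \<Gamma>: "\<Gamma> = G1 \<beta> a b"
      unfolding type_I_def by blast
    have \<beta>: "\<beta> \<noteq> 0" "cmod \<beta> < 1" using ad by (auto simp: admissible_def)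
    then have "(cmod \<beta>)\<^sup>2 < 1" by (simp add: power_less_one_iff)
    then have l: "cmod \<beta> powi (-2) > 1"
      using \<beta>(1) by (simp add: power_int_minus one_less_inverse)
    have "countable \<Gamma>" by (rule cnt[OF \<Gamma>[unfolded G1_def]]) (rule countable_range_insert)
    moreover have "(\<lambda>(w, z). (complex_of_real (cmod \<beta> powi (-2)) * w, \<beta> * z + 0)) \<in> \<Gamma>"
      unfolding \<Gamma> G1_def by (intro generate.incl) simp
    then have ?scaling using l \<beta> by (meson less_imp_le)
    moreover have ?translation
    proof -
      have "(\<chi> i. complex_of_real (a $ i)) \<noteq> 0"
        using co unfolding compatible_def Let_def by (metis insertI1 vec.dependent_zero)
      then obtain i where "a $ i \<noteq> 0" by (auto simp: vec_eq_iff)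
      moreover have "(\<lambda>(w, z). (w + complex_of_real (a $ i), z + 0 * w + b $ i)) \<in> \<Gamma>"
        unfolding \<Gamma> G1_def by (intro generate.incl) auto
      ultimately show ?thesis by blast
    qed
    ultimately show ?thesis by blast
  next
    case 2
    then obtain \<theta> :: int and \<alpha> and a b c :: "real ^ 2" and r t where \<theta>: "\<theta> \<ge> 3"
      "\<alpha> = (of_int \<theta> + sqrt ((of_int \<theta>)\<^sup>2 - 4)) / 2" and ind: "independent {a, b}"
      and \<Gamma>: "\<Gamma> = G2 \<alpha> a b c r t"
      unfolding type_II_def by blast
    have th: "(of_int \<theta> :: real) \<ge> 3" using \<theta>(1) by simp
    then have "(of_int \<theta> :: real)\<^sup>2 \<ge> 3\<^sup>2" by (intro power_mono) auto
    then have "sqrt ((of_int \<theta>)\<^sup>2 - 4) \<ge> 0" by simp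
    with th have "2 + 0 < real_of_int \<theta> + sqrt ((of_int \<theta>)\<^sup>2 - 4)"
      by (intro add_less_le_mono) auto
    then have l: "\<alpha> > 1" by (simp add: \<theta>(2))
    have "countable \<Gamma>" by (rule cnt[OF \<Gamma>[unfolded G2_def]]) (simp add: cheis)
    moreover have "(\<lambda>(w, z). (complex_of_real \<alpha> * w, 1 * z + t)) \<in> \<Gamma>"
      unfolding \<Gamma> G2_def by (intro generate.incl) simp
    then have ?scaling using l by (metis norm_one order_refl zero_neq_one)
    moreover have ?translation
      by (rule heisI[OF _ ind, of c r]) (auto simp: \<Gamma> G2_def intro: generate.incl)
    ultimately show ?thesis by blast
  next
    case 3
    then obtain \<theta> :: nat and \<alpha> and a b c :: "real ^ 2" and r where \<theta>: "\<theta> \<ge> 1"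
      "\<alpha> = (real \<theta> + sqrt ((real \<theta>)\<^sup>2 + 4)) / 2" and ind: "independent {a, b}"
      and \<Gamma>: "\<Gamma> = G3 \<alpha> a b c r"
      unfolding type_III_def by blast
    have "sqrt ((real \<theta>)\<^sup>2 + 4) > 1" by (simp add: add_nonneg_pos less_le_trans[of _ 4])
    moreover have "real \<theta> \<ge> 1" using \<theta>(1) by simp
    ultimately have "1 + 1 < real \<theta> + sqrt ((real \<theta>)\<^sup>2 + 4)"
      by (intro add_le_less_mono)
    then have l: "\<alpha> > 1" by (simp add: \<theta>(2))
    have "countable \<Gamma>" by (rule cnt[OF \<Gamma>[unfolded G3_def]]) (simp add: cheis)
    moreover have "(\<lambda>(w, z). (complex_of_real \<alpha> * w, -1 * z + 0)) \<in> \<Gamma>"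
      unfolding \<Gamma> G3_def by (intro generate.incl) simp
    then have ?scaling using l by (metis norm_minus_cancel norm_one order_refl zero_neq_neg_one)
    moreover have ?translation
      by (rule heisI[OF _ ind, of c r]) (auto simp: \<Gamma> G3_def intro: generate.incl)
    ultimately show ?thesis by blast
  qed
  then show "countable \<Gamma>" ?scaling ?translation by auto
qed

text \<open>Otherwise \<open>X\<close> would be a countable union of countable sets.\<close>

lemma uncountable_pigeonhole:
  assumes "countable C" "uncountable X" "\<And>x. x \<in> X \<Longrightarrow> \<exists>c\<in>C. P x c"
  obtains c where "c \<in> C" "uncountable {x\<in>X. P x c}"
proof -
  have "X = (\<Union>c\<in>C. {x\<in>X. P x c})" using assms(3) by auto
  then show thesis using assms(1,2) that by (metis (mono_tags, lifting) countable_UN)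
qed

text \<open>The element of \<open>\<Gamma>\<close> may a priori depend on the point. As \<open>\<Gamma>\<close> is countable, one element
  serves uncountably many \<open>w\<close>, hence all of them by the identity theorem.\<close>

lemma lift_equivariant:
  fixes l a :: real
  assumes hol: "h holomorphic_on upper_half" "A holomorphic_on upper_half" "B holomorphic_on upper_half"
    and F: "\<And>w z. w \<in> upper_half \<Longrightarrow> F (w, z) = (h w, A w * z + B w)"
    and \<Gamma>: "countable \<Gamma>" "\<Gamma> \<subseteq> Aff_U"
    and l: "l > 0"
    and eq: "\<And>w z. w \<in> upper_half \<Longrightarrow>
      \<exists>\<gamma>\<in>\<Gamma>. F (of_real l * w + of_real a, b * w + \<delta> * z + c) = \<gamma> (F (w, z))"
  obtains p u r s v where "p \<noteq> 0" "s \<noteq> 0"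
    "\<And>w. w \<in> upper_half \<Longrightarrow> h (of_real l * w + of_real a) = p * h w + u"
    "\<And>w. w \<in> upper_half \<Longrightarrow> A (of_real l * w + of_real a) * \<delta> = s * A w"
    "\<And>w. w \<in> upper_half \<Longrightarrow> A (of_real l * w + of_real a) * (b * w + c) + B (of_real l * w + of_real a)
      = r * h w + s * B w + v"
proof -
  define L where "L w = of_real l * w + of_real a" for w :: complex
  define E where "E w z \<gamma> \<longleftrightarrow> F (L w, b * w + \<delta> * z + c) = \<gamma> (F (w, z))" for w z \<gamma>
  have LH: "L w \<in> upper_half" if "w \<in> upper_half" for w
    unfolding L_def by (rule upper_half_affine[OF l that])
  \<comment> \<open>The pigeonhole is applied twice: first to the points \<open>z\<close> of one
    fibre, which gives an element depending on \<open>w\<close>, then to the base points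
    \<open>w\<close>.\<close>
  have "\<exists>\<gamma>\<in>\<Gamma>. uncountable {z. E w z \<gamma>}" if "w \<in> upper_half" for w
  proof -
    have "\<exists>\<gamma>\<in>\<Gamma>. E w z \<gamma>" for z using eq[OF that] by (simp add: E_def L_def)
    then obtain \<gamma> where "\<gamma> \<in> \<Gamma>" "uncountable {z\<in>UNIV. E w z \<gamma>}"
      by (rule uncountable_pigeonhole[OF \<Gamma>(1) uncountable_UNIV_complex])
    then show ?thesis by auto
  qed
  then obtain \<gamma> where "\<gamma> \<in> \<Gamma>"
    and unc: "uncountable {w\<in>upper_half. uncountable {z. E w z \<gamma>}}" (is "uncountable ?Z")
    by (rule uncountable_pigeonhole[OF \<Gamma>(1) uncountable_upper_half])
  then have "\<gamma> \<in> Aff_U" using \<Gamma>(2) by auto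
  then obtain p s u r v where ps: "p \<noteq> 0" "s \<noteq> 0"
    and \<gamma>: "\<And>w z. \<gamma> (w, z) = (p * w + u, r * w + s * z + v)"
    by (rule Aff_U_triangular) (rule that)
  \<comment> \<open>On such a fibre both sides are affine in \<open>z\<close> and agree at two
    different points, so their coefficients agree.\<close>
  have Z: "h (L w) = p * h w + u \<and> A (L w) * \<delta> = s * A w \<and>
      A (L w) * (b * w + c) + B (L w) = r * h w + s * B w + v" if "w \<in> ?Z" for w
  proof -
    from that have w: "w \<in> upper_half" and "infinite {z. E w z \<gamma>}" using countable_finite by auto
    then have "\<not> {z. E w z \<gamma>} \<subseteq> {x}" for x using finite_subset by blast
    then obtain x y where xy: "E w x \<gamma>" "E w y \<gamma>" "x \<noteq> y" by blast
    from xy(1) have h: "h (L w) = p * h w + u"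
      and x: "A (L w) * (b * w + \<delta> * x + c) + B (L w) = r * h w + s * (A w * x + B w) + v"
      by (simp_all add: E_def F w LH \<gamma>)
    from xy(2) have y: "A (L w) * (b * w + \<delta> * y + c) + B (L w) = r * h w + s * (A w * y + B w) + v"
      by (simp_all add: E_def F w LH \<gamma>)
    from x y have "(A (L w) * \<delta> - s * A w) * (x - y) = 0" by algebra
    with xy(3) have A: "A (L w) * \<delta> = s * A w" by simp
    with x have "A (L w) * (b * w + c) + B (L w) = r * h w + s * B w + v" by algebra
    with h A show ?thesis by simp
  qed
  have holL: "(\<lambda>w. f (L w)) holomorphic_on upper_half" if "f holomorphic_on upper_half" for f
  proof -
    have "L holomorphic_on upper_half"
      unfolding L_def by (intro holomorphic_intros)
    then have "f \<circ> L holomorphic_on upper_half"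
      by (rule holomorphic_on_compose_gen[OF _ that]) (use LH in auto)
    then show ?thesis by (simp add: o_def)
  qed
  have ident: "f w = 0" if "f holomorphic_on upper_half" "\<And>w. w \<in> ?Z \<Longrightarrow> f w = 0" "w \<in> upper_half" for f w
    by (rule uncountable_zeros_imp_zero[OF that(1) upper_half_open upper_half_connected _ unc that(2,3)]) auto
  have "h (L w) - (p * h w + u) = 0" if "w \<in> upper_half" for w
    by (rule ident[OF _ _ that]) (use Z in \<open>auto intro!: holomorphic_intros holL hol\<close>)
  moreover have "A (L w) * \<delta> - s * A w = 0" if "w \<in> upper_half" for w
    by (rule ident[OF _ _ that]) (use Z in \<open>auto intro!: holomorphic_intros holL hol\<close>)
  moreover have "A (L w) * (b * w + c) + B (L w) - (r * h w + s * B w + v) = 0" if "w \<in> upper_half" for w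
    by (rule ident[OF _ _ that]) (use Z in \<open>auto intro!: holomorphic_intros holL hol\<close>)
  ultimately show thesis using that[of p s u r v] ps unfolding L_def by simp
qed

text \<open>The commutator of the scaling and the translation is the translation by \<open>(l - 1) * a\<close>;
  the multipliers \<open>\<mu>\<close>, \<open>\<nu>\<close> cancel in it, so that it is a period of \<open>g\<close>.\<close>

lemma upper_half_multiplicative_constant:
  fixes l a :: real
  assumes hol: "g holomorphic_on upper_half" and l: "l > 1" and a: "a \<noteq> 0"
    and "\<mu> \<noteq> 0"
    and scale: "\<And>w. w \<in> upper_half \<Longrightarrow> g (of_real l * w) = \<mu> * g w"
    and transl: "\<And>w. w \<in> upper_half \<Longrightarrow> g (w + of_real a) = \<nu> * g w"
  obtains k where "\<And>w. w \<in> upper_half \<Longrightarrow> g w = k"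
proof (rule periodic_scaling_constant[OF hol l _ \<open>\<mu> \<noteq> 0\<close>])
  show "g (of_real l * w) = \<mu> * g w" if "w \<in> upper_half" for w by (rule scale[OF that])
  show "(l - 1) * a \<noteq> 0" using l a by simp
  fix w assume w: "w \<in> upper_half"
  \<comment> \<open>Starting from \<open>v\<close>, scaling and then translating leads to
    \<open>w\<close>, while translating and then scaling leads to \<open>w + (l - 1) * a\<close>.
    Both routes multiply \<open>g v\<close> by the same factor.\<close>
  define v where "v = (w - of_real a) / of_real l"
  have v: "v \<in> upper_half" using w l by (simp add: upper_half_def v_def Im_divide_of_real)
  have lv: "of_real l * v = w - of_real a" using l by (simp add: v_def)
  have v': "v + of_real a \<in> upper_half" "of_real l * v \<in> upper_half"
    using v l by (simp_all add: upper_half_def)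
  have "g (of_real l * v + of_real a) = g (of_real l * (v + of_real a))"
    by (simp add: scale transl v v')
  moreover have "of_real l * v + of_real a = w"
    "of_real l * (v + of_real a) = w + of_real ((l - 1) * a)"
    using lv by (simp_all add: algebra_simps)
  ultimately show "g (w + of_real ((l - 1) * a)) = g w" by metis
qed (rule that)

theorem theorem4p1:
  fixes \<Gamma>' \<Gamma>'' :: "(complex \<times> complex \<Rightarrow> complex \<times> complex) set"
    and f :: "(complex \<times> complex) set \<Rightarrow> (complex \<times> complex) set"
    and f_lift :: "complex \<times> complex \<Rightarrow> complex \<times> complex"
  assumes "inoue_group \<Gamma>'" and "inoue_group \<Gamma>''"
    and "quot_biholomorphic \<Gamma>' \<Gamma>'' f"
    and "biholomorphic2 f_lift U U"
    and "\<forall>x\<in>U. proj \<Gamma>'' (f_lift x) = f (proj \<Gamma>' x)"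
  shows "\<exists>F\<in>Aff_U. \<forall>x\<in>U. f_lift x = F x"
proof -

  \<comment> \<open>Compatibility of the lift with the orbits\<close>
  have sub': "subgroup \<Gamma>' Aff_U_group" and sub'': "subgroup \<Gamma>'' Aff_U_group"
    using assms(1,2) inoue_group_subgroup by auto
  have aff': "\<Gamma>' \<subseteq> Aff_U" and aff'': "\<Gamma>'' \<subseteq> Aff_U"
    using subgroup.subset[OF sub'] subgroup.subset[OF sub''] by (simp_all add: Aff_U_group_def)
  \<comment> \<open>The points \<open>x\<close> and \<open>g x\<close> lie over the same point of
    the first quotient, so their images under the lift lie over the same point of the second. At
    this stage \<open>\<gamma>\<close> may vary with \<open>x\<close>.\<close>
  have orbit: "\<exists>\<gamma>\<in>\<Gamma>''. f_lift (g x) = \<gamma> (f_lift x)" if g: "g \<in> \<Gamma>'" and x: "x \<in> U" for g x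
  proof -
    have gx: "g x \<in> U" using aff' g x by (auto simp: Aff_U_def)
    interpret group Aff_U_group by (rule group_Aff_U)
    define g' where "g' = inv\<^bsub>Aff_U_group\<^esub> g"
    have inv: "g' \<in> \<Gamma>'" unfolding g'_def using sub' g by (simp only: subgroup.m_inv_closed)
    have "g' \<otimes>\<^bsub>Aff_U_group\<^esub> g = \<one>\<^bsub>Aff_U_group\<^esub>"
      unfolding g'_def by (rule l_inv) (use aff' g in \<open>auto simp: Aff_U_group_def\<close>)
    then have "g' \<circ> g = id" by (simp add: Aff_U_group_def)
    then have ginv: "g' (g y) = y" for y by (metis comp_apply id_apply)
    have mult: "\<gamma> \<circ> \<gamma>' \<in> \<Gamma>'" if "\<gamma> \<in> \<Gamma>'" "\<gamma>' \<in> \<Gamma>'" for \<gamma> \<gamma>'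
      using subgroup.m_closed[OF sub' that] by (simp add: Aff_U_group_def)
    have "proj \<Gamma>' (g x) = proj \<Gamma>' x"
    proof (intro equalityI subsetI)
      fix y assume "y \<in> proj \<Gamma>' (g x)"
      then obtain \<gamma> where "\<gamma> \<in> \<Gamma>'" "y = (\<gamma> \<circ> g) x" by (auto simp: proj_def)
      then show "y \<in> proj \<Gamma>' x" unfolding proj_def using mult g by blast
    next
      fix y assume "y \<in> proj \<Gamma>' x"
      then obtain \<gamma> where "\<gamma> \<in> \<Gamma>'" "y = \<gamma> x" by (auto simp: proj_def)
      then have "y = (\<gamma> \<circ> g') (g x)" by (simp add: ginv)
      then show "y \<in> proj \<Gamma>' (g x)" unfolding proj_def using mult[OF \<open>\<gamma> \<in> \<Gamma>'\<close> inv] by blast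
    qed
    then have "proj \<Gamma>'' (f_lift (g x)) = proj \<Gamma>'' (f_lift x)" using assms(5) x gx by simp
    moreover have "id \<in> \<Gamma>''" using subgroup.one_closed[OF sub''] by (simp add: Aff_U_group_def)
    then have "f_lift (g x) \<in> proj \<Gamma>'' (f_lift (g x))" 
      unfolding proj_def by (intro CollectI exI[of _ id]) simp
    ultimately show ?thesis by (auto simp: proj_def)
  qed

  \<comment> \<open>Functional equations of the components of the lift\<close>
  obtain h A B where hol: "h holomorphic_on upper_half" "A holomorphic_on upper_half" "B holomorphic_on upper_half"
    and hinj: "inj_on h upper_half" and A0: "\<And>w. w \<in> upper_half \<Longrightarrow> A w \<noteq> 0"
    and F: "\<And>w z. w \<in> upper_half \<Longrightarrow> f_lift (w, z) = (h w, A w * z + B w)"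
    using biholomorphic_U_form[OF assms(4)] by metis
  note equiv = lift_equivariant[OF hol F inoue_group_elements(1)[OF assms(2)] aff'']
  obtain l :: real and \<delta> t where l: "l > 1" and \<delta>: "\<delta> \<noteq> 0" "cmod \<delta> \<le> 1"
    and g0: "(\<lambda>(w, z). (complex_of_real l * w, \<delta> * z + t)) \<in> \<Gamma>'"
    using inoue_group_elements(2)[OF assms(1)] by blast
  obtain a :: real and b c where a: "a \<noteq> 0"
    and g1: "(\<lambda>(w, z). (w + complex_of_real a, z + b * w + c)) \<in> \<Gamma>'"
    using inoue_group_elements(3)[OF assms(1)] by blast
  have l0: "l > 0" using l by simp
  \<comment> \<open>The terms \<open>of_real 0\<close> and \<open>0 * w\<close> bring the scaling
    into the form that covers the translation as well.\<close>
  have e0: "\<exists>\<gamma>\<in>\<Gamma>''. f_lift (of_real l * w + of_real 0, 0 * w + \<delta> * z + t) = \<gamma> (f_lift (w, z))"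
    if "w \<in> upper_half" for w z using orbit[OF g0, of "(w, z)"] that by simp
  \<comment> \<open>These are the coefficients of an element of \<open>\<Gamma>''\<close> to which
    the lift conjugates the scaling.\<close>
  obtain p0 u0 r0 s0 v0 where ps0: "p0 \<noteq> 0" "s0 \<noteq> 0"
    and h0: "\<And>w. w \<in> upper_half \<Longrightarrow> h (of_real l * w + of_real 0) = p0 * h w + u0"
    and A0': "\<And>w. w \<in> upper_half \<Longrightarrow> A (of_real l * w + of_real 0) * \<delta> = s0 * A w"
    and B0: "\<And>w. w \<in> upper_half \<Longrightarrow> A (of_real l * w + of_real 0) * (0 * w + t)
      + B (of_real l * w + of_real 0) = r0 * h w + s0 * B w + v0"
    by (rule equiv[where l = l and a = 0 and b = 0 and \<delta> = \<delta> and c = t, OF _ l0 e0])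
       (assumption | rule that)+
  have e1: "\<exists>\<gamma>\<in>\<Gamma>''. f_lift (of_real 1 * w + of_real a, b * w + 1 * z + c) = \<gamma> (f_lift (w, z))"
    if "w \<in> upper_half" for w z using orbit[OF g1, of "(w, z)"] that by (simp add: add_ac)
  obtain p1 u1 r1 s1 v1 where ps1: "p1 \<noteq> 0" "s1 \<noteq> 0"
    and h1: "\<And>w. w \<in> upper_half \<Longrightarrow> h (of_real 1 * w + of_real a) = p1 * h w + u1"
    and A1: "\<And>w. w \<in> upper_half \<Longrightarrow> A (of_real 1 * w + of_real a) * 1 = s1 * A w"
    and B1: "\<And>w. w \<in> upper_half \<Longrightarrow> A (of_real 1 * w + of_real a) * (b * w + c)
      + B (of_real 1 * w + of_real a) = r1 * h w + s1 * B w + v1"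
    by (rule equiv[where l = 1 and a = a and b = b and \<delta> = 1 and c = c, OF _ zero_less_one e1])
       (assumption | rule that)+

  \<comment> \<open>The first component is affine\<close>
  obtain k where k: "\<And>w. w \<in> upper_half \<Longrightarrow> deriv h w = k"
  proof (rule upper_half_multiplicative_constant[OF holomorphic_deriv[OF hol(1) upper_half_open] l a])
    show "p0 / of_real l \<noteq> 0" using ps0 l by simp
    show "deriv h (of_real l * w) = p0 / of_real l * deriv h w" if "w \<in> upper_half" for w
      using deriv_affine_relation[OF hol(1), of l 0 p0 0 u0 w] h0 l that by simp
    show "deriv h (w + of_real a) = p1 * deriv h w" if "w \<in> upper_half" for w
      using deriv_affine_relation[OF hol(1), of 1 a p1 0 u1 w] h1 that by simp
  qed (rule that)
  then obtain x where h: "\<And>w. w \<in> upper_half \<Longrightarrow> h w = k * w + x"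
    using upper_half_deriv_constant[OF hol(1)] by blast
  have "k \<noteq> 0"
    using k holomorphic_injective_imp_regular[OF hol(1) upper_half_open hinj i_in_upper_half] i_in_upper_half by auto

  \<comment> \<open>The coefficient of \<open>z\<close> is constant\<close>
  obtain m where m: "\<And>w. w \<in> upper_half \<Longrightarrow> A w = m"
  proof (rule upper_half_multiplicative_constant[OF hol(2) l a])
    show "s0 / \<delta> \<noteq> 0" using ps0 \<delta> by simp
    show "A (of_real l * w) = s0 / \<delta> * A w" if "w \<in> upper_half" for w
      using A0'[OF that] \<delta> by (simp add: field_simps)
    show "A (w + of_real a) = s1 * A w" if "w \<in> upper_half" for w
      using A1[OF that] by simp
  qed (rule that)
  have "m \<noteq> 0" using m A0 i_in_upper_half by metis
  have li: "of_real l * w \<in> upper_half" "w + of_real a \<in> upper_half" if "w \<in> upper_half" for w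
    using l that by (simp_all add: upper_half_def)
  \<comment> \<open>With \<open>A\<close> equal to the nonzero constant \<open>m\<close>, the
    scaling relation reads \<open>m * \<delta> = s0 * m\<close>. This fixes the multiplier of
    \<open>B\<close> under the scaling.\<close>
  have s0: "s0 = \<delta>"
    using A0'[OF i_in_upper_half] m li[OF i_in_upper_half] i_in_upper_half \<open>m \<noteq> 0\<close> by simp

  \<comment> \<open>The remaining term is affine\<close>
  have B0': "B (of_real l * w + of_real 0) = \<delta> * B w + r0 * k * w + (r0 * x + v0 - m * t)"
    if "w \<in> upper_half" for w
    using B0[OF that] m[OF li(1)[OF that]] h[OF that] by (simp add: s0 algebra_simps)
  have B1': "B (of_real 1 * w + of_real a) = s1 * B w + (r1 * k - m * b) * w + (r1 * x + v1 - m * c)"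
    if "w \<in> upper_half" for w
    using B1[OF that] m[OF li(2)[OF that]] h[OF that] by (simp add: algebra_simps)
  have holB': "deriv B holomorphic_on upper_half" by (rule holomorphic_deriv[OF hol(3) upper_half_open])
  \<comment> \<open>The summand \<open>0 * w\<close> keeps the shape that a second differentiation
    by \<open>deriv_affine_relation\<close> takes as its premise.\<close>
  have B0'': "deriv B (of_real l * w + of_real 0) = \<delta> / of_real l * deriv B w + 0 * w + r0 * k / of_real l"
    if "w \<in> upper_half" for w
    using deriv_affine_relation[OF hol(3) l0 B0' that] by simp
  have B1'': "deriv B (of_real 1 * w + of_real a) = s1 * deriv B w + 0 * w + (r1 * k - m * b)"
    if "w \<in> upper_half" for w
    using deriv_affine_relation[OF hol(3) zero_less_one B1' that] by simp
  have scale: "deriv (deriv B) (of_real l * w) = \<delta> / (of_real l)\<^sup>2 * deriv (deriv B) w"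
    if "w \<in> upper_half" for w
    using deriv_affine_relation[OF holB' l0 B0'' that] by (simp add: power2_eq_square)
  obtain n where n: "\<And>w. w \<in> upper_half \<Longrightarrow> deriv (deriv B) w = n"
  proof (rule upper_half_multiplicative_constant[OF holomorphic_deriv[OF holB' upper_half_open] l a])
    show "deriv (deriv B) (of_real l * w) = \<delta> / (of_real l)\<^sup>2 * deriv (deriv B) w"
      if "w \<in> upper_half" for w by (rule scale[OF that])
    show "\<delta> / (of_real l)\<^sup>2 \<noteq> 0" using \<delta> l by simp
    show "deriv (deriv B) (w + of_real a) = s1 * deriv (deriv B) w" if "w \<in> upper_half" for w
      using deriv_affine_relation[OF holB' zero_less_one B1'' that] by simp
  qed (rule that)
  have "n = 0"
  proof (rule ccontr)
    assume "n \<noteq> 0"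
    moreover have "n = \<delta> / (of_real l)\<^sup>2 * n"
      using scale[OF i_in_upper_half] n li[OF i_in_upper_half] i_in_upper_half by simp
    ultimately have "\<delta> = (of_real l)\<^sup>2" using l by (simp add: field_simps)
    then have "cmod \<delta> = l\<^sup>2" by (simp add: norm_power)
    moreover have "l\<^sup>2 > 1" using l by (simp add: one_less_power)
    ultimately show False using \<delta>(2) by simp
  qed
  with n obtain q where "\<And>w. w \<in> upper_half \<Longrightarrow> deriv B w = q"
    using upper_half_deriv_constant[OF holB', of 0] by auto
  then obtain y where B: "\<And>w. w \<in> upper_half \<Longrightarrow> B w = q * w + y"
    using upper_half_deriv_constant[OF hol(3)] by blast

  \<comment> \<open>The affine map that extends the lift\<close>
  define G where "G = (\<lambda>(w, z). (k * w + 0 * z + x, q * w + m * z + y))"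
  have fG: "f_lift v = G v" if "v \<in> U" for v
    using that by (cases v) (simp add: F h m B G_def)
  have "k * m - 0 * q \<noteq> 0" using \<open>k \<noteq> 0\<close> \<open>m \<noteq> 0\<close> by simp
  then have "affine_transformation G" unfolding affine_transformation_def G_def by blast
  moreover have "G ` U = U"
    using assms(4) fG by (simp add: biholomorphic2_def bij_betw_def)
  ultimately show ?thesis using fG by (auto simp: Aff_U_def)
qed

end
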